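(* Let $S$ be a topological monoid with open shifts. Then the following statements are equivalent: (i) $S$ has countable cellularity; (ii) $\mathcal{C}_0(S)$ has countable cellularity; (iii) $\mathcal{C}_1(S)$ has countable cellularity; (iv) $\mathcal{C}_2(S)$ has countable cellularity; (v) $\mathcal{C}_3(S)$ has countable cellularity; (vi) $\mathcal{C}_r(S)$ has countable cellularity.
   Context: A topological monoid is a monoid $S$ with a topology (no separation axiom assumed) for which the operation $S\times S\to S$ is continuous. It has open shifts if for every $a\in S$ and every open $U\subseteq S$ the sets $aU$ and $Ua$ are open in $S$. A cellular family in a space $X$ is a nonempty family of pairwise disjoint nonempty open subsets of $X$; the cellularity is $c(X)=\sup\{|\mathcal{U}|:\mathcal{U}\text{ a cellular family in }X\}+\aleph_0$, and $X$ has countable cellularity (the Souslin property) if $c(X)=\aleph_0$. A space is $T_3$ if every point and every closed set not containing it have disjoint open neighborhoods ($T_1$ is not assumed); a space is regular if it is $T_3$ and $T_1$. $\mathcal{C}_0,\mathcal{C}_1,\mathcal{C}_2,\mathcal{C}_3,\mathcal{C}_r$ denote the classes of $T_0$, $T_1$, $T_2$, $T_3$ and regular spaces. Each such class $\mathcal{C}$ is epireflective in the category of topological spaces: for each space $X$ there is a space $\mathcal{C}(X)\in\mathcal{C}$ and a continuous surjection $\varphi\colon X\to\mathcal{C}(X)$ such that every continuous map $f\colon X\to Y$ with $Y\in\mathcal{C}$ factors as $f=g\circ\varphi$ for a unique continuous $g$; $\mathcal{C}(X)$ is unique up to homeomorphism. *)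

theory Defs
  imports "HOL-Analysis.Analysis" "HOL-Algebra.Coset" "HOL-Library.Countable_Set_Type"
begin

unbundle cardinal_syntax

locale topological_monoid = monoid S for S (structure) +
  fixes T :: "'a topology"
  assumes topspace_eq: "topspace T = carrier S"
    and continuous_mult: "continuous_map (prod_topology T T) T (\<lambda>(x, y). x \<otimes> y)"

definition open_shifts :: "('a, 'm) monoid_scheme \<Rightarrow> 'a topology \<Rightarrow> bool" where
  "open_shifts S T \<longleftrightarrow>
     (\<forall>a\<in>carrier S. \<forall>U. openin T U \<longrightarrow> openin T (a <#\<^bsub>S\<^esub> U) \<and> openin T (U #>\<^bsub>S\<^esub> a))"

definition cellular_family :: "'a topology \<Rightarrow> 'a set set \<Rightarrow> bool" where
  "cellular_family X \<U> \<longleftrightarrow>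
     \<U> \<noteq> {} \<and> (\<forall>U\<in>\<U>. openin X U \<and> U \<noteq> {}) \<and> pairwise disjnt \<U>"

text \<open>The supremum of a set of cardinals. Cardinals are represented, up to \<open>=o\<close>, by cardinal
  orders as in the cardinal theory of Main; the supremum is the least cardinal order above
  all members. If the members are cardinal orders on subsets of a type, then so is the supremum.\<close>

definition is_card_Sup :: "'b rel set \<Rightarrow> 'b rel \<Rightarrow> bool" where
  "is_card_Sup K r \<longleftrightarrow> Card_order r \<and> (\<forall>k\<in>K. k \<le>o r) \<and>
     (\<forall>r' :: 'b rel. Card_order r' \<and> (\<forall>k\<in>K. k \<le>o r') \<longrightarrow> r \<le>o r')"

definition card_Sup :: "'b rel set \<Rightarrow> 'b rel" where
  "card_Sup K = (SOME r. is_card_Sup K r)"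

definition cellularity :: "'a topology \<Rightarrow> ('a set + nat) rel" where
  "cellularity X = card_Sup {|\<U>| | \<U>. cellular_family X \<U>} +c natLeq"

definition countable_cellularity :: "'a topology \<Rightarrow> bool" where
  "countable_cellularity X \<longleftrightarrow> cellularity X =o natLeq"

lemma is_card_Sup_card_Sup:
  fixes K :: "'b rel set"
  assumes "\<forall>k\<in>K. Card_order k"
  shows "is_card_Sup K (card_Sup K)"
proof -
  let ?B = "{r :: 'b rel. Card_order r \<and> (\<forall>k\<in>K. k \<le>o r)}"
  have "k \<le>o |UNIV :: 'b set|" if "k \<in> K" for k
    using that assms card_of_Field_ordIso card_of_mono1[OF subset_UNIV, of "Field k"]
      ordIso_ordLeq_trans ordIso_symmetric by blast
  then have "|UNIV :: 'b set| \<in> ?B" by (simp add: card_of_Card_order)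
  then have "\<exists>r\<in>?B. \<forall>r'\<in>?B. r \<le>o r'"
    by (intro exists_minim_Card_order) auto
  then obtain r where "is_card_Sup K r"
    unfolding is_card_Sup_def by blast
  then show ?thesis
    unfolding card_Sup_def by (rule someI)
qed

lemma countable_cellularity_iff:
  fixes X :: "'a topology"
  shows "countable_cellularity X \<longleftrightarrow> (\<forall>\<U>. cellular_family X \<U> \<longrightarrow> countable \<U>)"
proof -
  let ?K = "{|\<U>| | \<U>. cellular_family X \<U>}"
  have sup: "is_card_Sup ?K (card_Sup ?K)"
    by (rule is_card_Sup_card_Sup) (auto simp: card_of_Card_order)
  then have C: "Card_order (card_Sup ?K)"
    and upper: "\<And>k. k \<in> ?K \<Longrightarrow> k \<le>o card_Sup ?K"
    and least: "\<And>r :: 'a set rel. Card_order r \<Longrightarrow> \<forall>k\<in>?K. k \<le>o r \<Longrightarrow> card_Sup ?K \<le>o r"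
    unfolding is_card_Sup_def by simp_all
  show ?thesis
  proof
    assume "countable_cellularity X"
    then have le: "card_Sup ?K \<le>o natLeq"
      unfolding countable_cellularity_def cellularity_def
      by (rule ordLeq_ordIso_trans[OF ordLeq_csum1[OF C]])
    show "\<forall>\<U>. cellular_family X \<U> \<longrightarrow> countable \<U>"
    proof (intro allI impI)
      fix \<U> assume "cellular_family X \<U>"
      then have "|\<U>| \<le>o card_Sup ?K" by (intro upper) auto
      then show "countable \<U>"
        using ordLeq_transitive[OF _ le] by (simp add: countable_card_le_natLeq)
    qed
  next
    assume R: "\<forall>\<U>. cellular_family X \<U> \<longrightarrow> countable \<U>"
    have "card_Sup ?K \<le>o natLeq"
    proof (cases "finite (UNIV :: 'a set set)")
      case True
      have "finite (Field (card_Sup ?K))"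
        by (rule finite_subset[OF subset_UNIV True])
      then have "|Field (card_Sup ?K)| \<le>o natLeq"
        unfolding countable_card_le_natLeq[symmetric] by (rule countable_finite)
      then show ?thesis
        by (rule ordIso_ordLeq_trans[OF ordIso_symmetric[OF card_of_Field_ordIso[OF C]]])
    next
      case False
      then obtain N :: "'a set set" where N: "infinite N" "countable N"
        using infinite_countable_subset' by blast
      have le: "|\<U>| \<le>o |N|" if "cellular_family X \<U>" for \<U>
      proof (rule ordLeq_transitive)
        show "|\<U>| \<le>o natLeq"
          using R that by (simp flip: countable_card_le_natLeq)
        show "natLeq \<le>o |N|"
          using N(1) infinite_iff_natLeq_ordLeq[of N] by blast
      qed
      have "card_Sup ?K \<le>o |N|"
        by (rule least[OF card_of_Card_order]) (use le in auto)
      moreover have "|N| \<le>o natLeq"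
        using N(2) by (simp flip: countable_card_le_natLeq)
      ultimately show ?thesis by (rule ordLeq_transitive)
    qed
    then show "countable_cellularity X"
      unfolding countable_cellularity_def cellularity_def
      by (rule csum_absorb2[OF natLeq_Cinfinite])
  qed
qed

text \<open>The separation axioms. Note that \<^const>\<open>regular_space\<close> of the library does not include T1.\<close>

datatype separation = T0 | T1 | T2 | T3 | Regular

primrec in_class :: "separation \<Rightarrow> 'a topology \<Rightarrow> bool" where
  "in_class T0 X \<longleftrightarrow> t0_space X"
| "in_class T1 X \<longleftrightarrow> t1_space X"
| "in_class T2 X \<longleftrightarrow> Hausdorff_space X"
| "in_class T3 X \<longleftrightarrow> regular_space X"
| "in_class Regular X \<longleftrightarrow> regular_space X \<and> t1_space X"

text \<open>\<open>reflection c X R \<phi>\<close> says that \<open>R\<close>, together with \<open>\<phi>\<close>, is the reflection of \<open>X\<close> in the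
  class \<open>c\<close>. A definition cannot quantify over the types carrying the test spaces \<open>Y\<close>; they are
  taken on the type of the points of \<open>X\<close>. This is no restriction, since the image of a map
  from \<open>X\<close> has at most as many points as \<open>X\<close>: see lemma \<open>reflection_universal\<close>. Lemma
  \<open>reflection_exists\<close> shows that reflections exist. The factorisation is unique as a
  function on the points of \<open>R\<close>, whence the use of \<^const>\<open>extensional\<close>.\<close>

definition reflection :: "separation \<Rightarrow> 'a topology \<Rightarrow> 'b topology \<Rightarrow> ('a \<Rightarrow> 'b) \<Rightarrow> bool" where
  "reflection c X R \<phi> \<longleftrightarrow>
     in_class c R \<and> continuous_map X R \<phi> \<and> \<phi> ` topspace X = topspace R \<and>
     (\<forall>(Y :: 'a topology) f. in_class c Y \<and> continuous_map X Y f \<longrightarrow>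
        (\<exists>!g. g \<in> extensional (topspace R) \<and> continuous_map R Y g \<and>
              (\<forall>x\<in>topspace X. f x = g (\<phi> x))))"

lemma in_class_homeomorphic:
  assumes "X homeomorphic_space Y"
  shows "in_class c X \<longleftrightarrow> in_class c Y"
  using homeomorphic_t0_space[OF assms] homeomorphic_t1_space[OF assms]
    homeomorphic_Hausdorff_space[OF assms] homeomorphic_regular_space[OF assms]
  by (cases c) auto

lemma in_class_subtopology: "in_class c X \<Longrightarrow> in_class c (subtopology X A)"
  by (cases c) (auto simp: t0_space_subtopology t1_space_subtopology
      Hausdorff_space_subtopology regular_space_subtopology)

lemma in_class_product:
  "(\<And>i. i \<in> I \<Longrightarrow> in_class c (X i)) \<Longrightarrow> in_class c (product_topology X I)"
  by (cases c) (auto simp: t0_space_product_topology t1_space_product_topology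
      Hausdorff_space_product_topology regular_space_product_topology)

lemma in_class_pullback:
  assumes c: "in_class c Y" and inj: "inj_on f A" and sub: "f ` A \<subseteq> topspace Y"
  shows "in_class c (pullback_topology A f Y)"
proof -
  let ?P = "pullback_topology A f Y" and ?Q = "subtopology Y (f ` A)"
  have top: "topspace ?P = A" "topspace ?Q = f ` A"
    using sub by (auto simp: topspace_pullback_topology)
  have "continuous_map ?P Y f"
    using continuous_map_pullback[OF continuous_map_id, of A f Y] by simp
  then have "continuous_map ?P ?Q f"
    using top by (auto simp: continuous_map_in_subtopology)
  moreover have "open_map ?P ?Q f"
    unfolding open_map_def openin_pullback_topology openin_subtopology by blast
  ultimately have "homeomorphic_map ?P ?Q f"
    using top inj by (intro bijective_open_imp_homeomorphic_map) auto
  then show ?thesis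
    using in_class_homeomorphic in_class_subtopology[OF c] homeomorphic_map_imp_homeomorphic_space
    by blast
qed

lemma reflection_universal:
  fixes X :: "'a topology" and R :: "'b topology" and Y :: "'d topology"
  assumes r: "reflection c X R \<phi>" and Y: "in_class c Y" and f: "continuous_map X Y f"
  shows "\<exists>!g. g \<in> extensional (topspace R) \<and> continuous_map R Y g \<and>
              (\<forall>x\<in>topspace X. f x = g (\<phi> x))"
proof -
  define h where "h = inv_into (topspace X) f"
  define A where "A = h ` f ` topspace X"
  have fh: "f (h y) = y" if "y \<in> f ` topspace X" for y
    using that unfolding h_def by (rule f_inv_into_f)
  have A: "f ` A = f ` topspace X" "inj_on f A"
  proof -
    have "f ` A = (\<lambda>y. f (h y)) ` f ` topspace X"
      unfolding A_def by (rule image_image)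
    also have "\<dots> = (\<lambda>y. y) ` f ` topspace X"
      by (rule image_cong[OF refl]) (rule fh)
    finally show "f ` A = f ` topspace X" by simp
    show "inj_on f A"
      unfolding A_def by (rule inj_on_inverseI[of _ h]) (use fh in auto)
  qed
  have sub: "f ` topspace X \<subseteq> topspace Y"
    using f continuous_map_image_subset_topspace by blast
  let ?P = "pullback_topology A f Y"
  have P: "in_class c ?P"
    using in_class_pullback[OF Y A(2)] A(1) sub by simp
  have "continuous_map X ?P (h \<circ> f)"
  proof (rule continuous_map_pullback')
    show "continuous_map X Y (f \<circ> (h \<circ> f))"
      by (rule continuous_map_eq[OF f]) (simp add: fh)
    show "topspace X \<subseteq> (h \<circ> f) -` A"
      unfolding A_def by auto
  qed
  then obtain g where g: "continuous_map R ?P g" "\<forall>x\<in>topspace X. (h \<circ> f) x = g (\<phi> x)"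
    using r P unfolding reflection_def by blast
  have img: "\<phi> ` topspace X = topspace R"
    using r unfolding reflection_def by blast
  let ?g = "restrict (f \<circ> g) (topspace R)"
  have "continuous_map ?P Y f"
    using continuous_map_pullback[OF continuous_map_id, of A f Y] by simp
  then have "continuous_map R Y (f \<circ> g)"
    using g(1) continuous_map_compose by blast
  then have "continuous_map R Y ?g"
    by (rule continuous_map_eq) simp
  moreover have eq: "\<forall>x\<in>topspace X. f x = ?g (\<phi> x)"
    using g(2) fh img by (metis comp_apply image_eqI restrict_apply')
  moreover have "g' = ?g" if "g' \<in> extensional (topspace R)"
    "\<forall>x\<in>topspace X. f x = g' (\<phi> x)" for g'
  proof (rule extensionalityI[OF that(1)])
    show "?g \<in> extensional (topspace R)" by simp
    show "g' y = ?g y" if "y \<in> topspace R" for y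
      using that \<open>\<forall>x\<in>topspace X. f x = g' (\<phi> x)\<close> eq img by (metis imageE)
  qed
  ultimately show ?thesis
    by (intro ex1I[of _ ?g]) auto
qed

lemma reflection_exists:
  fixes X :: "'a topology"
  shows "\<exists>(R :: 'a topology) \<phi>. reflection c X R \<phi>"
proof -
  define I where "I = {(Y :: 'a topology, f :: 'a \<Rightarrow> 'a). in_class c Y \<and> continuous_map X Y f}"
  define P where "P = product_topology fst I"
  define e where "e = (\<lambda>x. \<lambda>i\<in>I. snd i x)"
  define h where "h = inv_into (topspace X) e"
  define A where "A = h ` e ` topspace X"
  define R where "R = pullback_topology A e P"
  have eh: "e (h y) = y" if "y \<in> e ` topspace X" for y
    using that unfolding h_def by (rule f_inv_into_f)
  have A: "e ` A = e ` topspace X" "inj_on e A"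
  proof -
    have "e ` A = (\<lambda>y. e (h y)) ` e ` topspace X"
      unfolding A_def by (rule image_image)
    also have "\<dots> = (\<lambda>y. y) ` e ` topspace X"
      by (rule image_cong[OF refl]) (rule eh)
    finally show "e ` A = e ` topspace X" by simp
    show "inj_on e A"
      unfolding A_def by (rule inj_on_inverseI[of _ h]) (use eh in auto)
  qed
  have P: "in_class c P"
    unfolding P_def I_def by (rule in_class_product) auto
  have e: "continuous_map X P e"
    unfolding P_def e_def continuous_map_componentwise by (auto simp: I_def)
  then have sub: "e ` topspace X \<subseteq> topspace P"
    using continuous_map_image_subset_topspace by blast
  have R: "in_class c R"
    unfolding R_def using in_class_pullback[OF P A(2)] A(1) sub by simp
  have top: "topspace R = A"
    unfolding R_def using A(1) sub by (auto simp: topspace_pullback_topology)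
  have cont: "continuous_map X R (h \<circ> e)"
    unfolding R_def
  proof (rule continuous_map_pullback')
    show "continuous_map X P (e \<circ> (h \<circ> e))"
      by (rule continuous_map_eq[OF e]) (simp add: eh)
    show "topspace X \<subseteq> (h \<circ> e) -` A"
      unfolding A_def by auto
  qed
  have img: "(h \<circ> e) ` topspace X = topspace R"
    unfolding top A_def by (simp add: image_comp)
  have "\<exists>!g. g \<in> extensional (topspace R) \<and> continuous_map R Y g \<and>
              (\<forall>x\<in>topspace X. f x = g ((h \<circ> e) x))"
    if Y: "in_class c Y" and f: "continuous_map X Y f" for Y :: "'a topology" and f
  proof -
    have i: "(Y, f) \<in> I" using Y f unfolding I_def by simp
    let ?g = "restrict f (topspace R)"
    have "continuous_map P Y (\<lambda>z. z (Y, f))"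
      unfolding P_def using continuous_map_product_projection[OF i, of fst] by simp
    then have "continuous_map R Y ((\<lambda>z. z (Y, f)) \<circ> e)"
      unfolding R_def by (rule continuous_map_pullback)
    then have "continuous_map R Y ?g"
      by (rule continuous_map_eq) (simp add: e_def i)
    moreover have eq: "f x = ?g ((h \<circ> e) x)" if x: "x \<in> topspace X" for x
    proof -
      have "e (h (e x)) = e x" using eh x by blast
      then have "e (h (e x)) (Y, f) = e x (Y, f)" by simp
      moreover have "h (e x) \<in> topspace R" using img x by auto
      ultimately show ?thesis by (simp add: e_def i)
    qed
    moreover have "g' = ?g" if "g' \<in> extensional (topspace R)"
      "\<forall>x\<in>topspace X. f x = g' ((h \<circ> e) x)" for g'
    proof (rule extensionalityI[OF that(1)])
      show "?g \<in> extensional (topspace R)" by simp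
      show "g' y = ?g y" if "y \<in> topspace R" for y
        using that \<open>\<forall>x\<in>topspace X. f x = g' ((h \<circ> e) x)\<close> eq img by (metis imageE)
    qed
    ultimately show ?thesis
      by (intro ex1I[of _ ?g]) auto
  qed
  then have "reflection c X R (h \<circ> e)"
    unfolding reflection_def using R cont img by blast
  then show ?thesis by blast
qed

end

theory Submission
  imports Defs
begin

text \<open>Open sets and the interiors of their closures are disjoint simultaneously, so a space and its
  semiregularization (the topology generated by the sets \<open>int (cl U)\<close>) have the same cellularity.
  If \<open>S\<close> is a monoid with open shifts, its semiregularization is regular: given an open
  \<open>U \<ni> x = x e\<close>, pick open \<open>W \<ni> x\<close> and \<open>V \<ni> e\<close> with \<open>W V \<subseteq> U\<close>; for \<open>y \<in> cl W\<close> the open set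
  \<open>y V \<ni> y\<close> lies in \<open>cl (W V) \<subseteq> cl U\<close>, whence \<open>cl W \<subseteq> int (cl U)\<close>. The Kolmogorov quotient of the
  semiregularization therefore belongs to all five classes, so the canonical map from \<open>S\<close> to it
  factors through each reflection, and cellular families of \<open>S\<close> pass to the reflections.\<close>

section \<open>Counting cellular families\<close>

text \<open>Nonempty disjoint sets are distinct, so \<open>F\<close> is injective on
  \<open>I\<close>. Indexing lets the preimages of a family be counted by the family itself.\<close>

lemma countable_cellularity_indexed:
  assumes "countable_cellularity X"
    and op: "\<And>i. i \<in> I \<Longrightarrow> openin X (F i)" and ne: "\<And>i. i \<in> I \<Longrightarrow> F i \<noteq> {}"
    and disj: "\<And>i j. i \<in> I \<Longrightarrow> j \<in> I \<Longrightarrow> i \<noteq> j \<Longrightarrow> disjnt (F i) (F j)"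
  shows "countable I"
proof (cases "I = {}")
  case False
  have "cellular_family X (F ` I)"
    unfolding cellular_family_def pairwise_def using False op ne disj by blast
  then have "countable (F ` I)"
    using assms(1) by (simp add: countable_cellularity_iff)
  moreover have "inj_on F I"
    by (rule inj_onI) (metis disj disjnt_self_iff_empty ne)
  ultimately show ?thesis
    by (simp add: countable_image_inj_eq)
qed simp

text \<open>Preimages of a cellular family stay open and disjoint, and surjectivity keeps them
  nonempty.\<close>

lemma countable_cellularity_continuous_image:
  assumes X: "countable_cellularity X" and f: "continuous_map X Y f"
    and surj: "f ` topspace X = topspace Y"
  shows "countable_cellularity Y"
  unfolding countable_cellularity_iff
proof (intro allI impI)
  fix \<U> assume \<U>: "cellular_family Y \<U>"
  show "countable \<U>"
  proof (rule countable_cellularity_indexed[OF X])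
    fix U assume "U \<in> \<U>"
    then have U: "openin Y U" "U \<noteq> {}"
      using \<U> unfolding cellular_family_def by auto
    show "openin X {x \<in> topspace X. f x \<in> U}"
      using openin_continuous_map_preimage[OF f U(1)] .
    have "U \<subseteq> f ` topspace X"
      using openin_subset[OF U(1)] surj by simp
    then show "{x \<in> topspace X. f x \<in> U} \<noteq> {}"
      using U(2) by blast
  next
    fix U V assume "U \<in> \<U>" "V \<in> \<U>" "U \<noteq> V"
    then have "disjnt U V"
      using \<U> unfolding cellular_family_def pairwise_def by blast
    then show "disjnt {x \<in> topspace X. f x \<in> U} {x \<in> topspace X. f x \<in> V}"
      by (auto simp: disjnt_iff)
  qed
qed

section \<open>Regular open sets and the semiregularization\<close>

text \<open>An open set missing a set also misses its closure. This is applied twice: to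
  \<open>V\<close> and \<open>U\<close>, then to \<open>?A\<close> and \<open>V\<close>.\<close>

lemma disjnt_interior_of_closure_of:
  assumes "openin X U" "openin X V" "disjnt U V"
  shows "disjnt (X interior_of (X closure_of U)) (X interior_of (X closure_of V))"
proof -
  let ?A = "X interior_of (X closure_of U)" and ?B = "X interior_of (X closure_of V)"
  have "V \<inter> X closure_of U = {}"
    using assms by (auto simp: openin_Int_closure_of_eq_empty disjnt_def)
  then have "?A \<inter> V = {}"
    using interior_of_subset[of X "X closure_of U"] by blast
  then have "?A \<inter> X closure_of V = {}"
    by (simp add: openin_Int_closure_of_eq_empty)
  then show ?thesis
    using interior_of_subset[of X "X closure_of V"] unfolding disjnt_def by blast
qed

text \<open>The regular open sets \<open>int (cl U)\<close> form a base; the pointwise condition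
  lets openness unfold directly. Asking for \<open>x\<close> in \<open>U\<close> rather than in
  \<open>int (cl U)\<close> gives the same topology, as \<open>int cl\<close> is idempotent.\<close>

definition semiregularization :: "'a topology \<Rightarrow> 'a topology" where
  "semiregularization X = topology (\<lambda>W. \<forall>x\<in>W. \<exists>U. openin X U \<and> x \<in> U \<and>
     X interior_of (X closure_of U) \<subseteq> W)"

lemma openin_semiregularization:
  "openin (semiregularization X) W \<longleftrightarrow>
     (\<forall>x\<in>W. \<exists>U. openin X U \<and> x \<in> U \<and> X interior_of (X closure_of U) \<subseteq> W)"
proof -
  let ?L = "\<lambda>W. \<forall>x\<in>W. \<exists>U. openin X U \<and> x \<in> U \<and> X interior_of (X closure_of U) \<subseteq> W"
  have "istopology ?L"
    unfolding istopology_def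
  proof (intro conjI allI impI)
    fix A B assume A: "?L A" and B: "?L B"
    show "?L (A \<inter> B)"
    proof
      fix x assume x: "x \<in> A \<inter> B"
      obtain U where U: "openin X U" "x \<in> U" "X interior_of (X closure_of U) \<subseteq> A"
        using A x by blast
      obtain V where V: "openin X V" "x \<in> V" "X interior_of (X closure_of V) \<subseteq> B"
        using B x by blast
      have "X interior_of (X closure_of (U \<inter> V)) \<subseteq> X interior_of (X closure_of U)"
        "X interior_of (X closure_of (U \<inter> V)) \<subseteq> X interior_of (X closure_of V)"
        by (simp_all add: interior_of_mono closure_of_mono)
      then show "\<exists>W. openin X W \<and> x \<in> W \<and> X interior_of (X closure_of W) \<subseteq> A \<inter> B"
        using U V by (intro exI[of _ "U \<inter> V"]) auto
    qed
  next
    fix \<K> assume "\<forall>K\<in>\<K>. ?L K"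
    then show "?L (\<Union>\<K>)" by (meson Union_iff Union_upper subset_trans)
  qed
  then show ?thesis
    unfolding semiregularization_def by (simp add: topology_inverse')
qed

lemma openin_imp_subset_interior_of_closure_of:
  "openin X U \<Longrightarrow> U \<subseteq> X interior_of (X closure_of U)"
  by (simp add: interior_of_maximal closure_of_subset openin_subset)

text \<open>Since \<open>U\<close> lies in \<open>int (cl U)\<close>, it is a neighbourhood of
  \<open>x\<close> inside \<open>W\<close>. Continuity on the semiregularization thus carries over
  to \<open>X\<close>.\<close>

lemma openin_semiregularization_imp_openin:
  assumes "openin (semiregularization X) W"
  shows "openin X W"
proof (subst openin_subopen, intro ballI)
  fix x assume "x \<in> W"
  then obtain U where "openin X U" "x \<in> U" "X interior_of (X closure_of U) \<subseteq> W"
    using assms unfolding openin_semiregularization by blast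
  then show "\<exists>U. openin X U \<and> x \<in> U \<and> U \<subseteq> W"
    using openin_imp_subset_interior_of_closure_of by (metis subset_trans)
qed

text \<open>By idempotence of \<open>int cl\<close>, the set is its own witness at each of its
  points.\<close>

lemma openin_semiregularization_interior_of_closure_of:
  "openin (semiregularization X) (X interior_of (X closure_of U))"
  unfolding openin_semiregularization
proof
  let ?A = "X interior_of (X closure_of U)"
  fix x assume "x \<in> ?A"
  moreover have "X closure_of ?A \<subseteq> X closure_of U"
    by (simp add: closure_of_minimal interior_of_subset)
  ultimately show "\<exists>V. openin X V \<and> x \<in> V \<and> X interior_of (X closure_of V) \<subseteq> ?A"
    by (intro exI[of _ ?A]) (simp add: interior_of_mono)
qed

lemma topspace_semiregularization [simp]: "topspace (semiregularization X) = topspace X"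
proof
  show "topspace (semiregularization X) \<subseteq> topspace X"
    by (simp add: openin_semiregularization_imp_openin openin_subset)
  have "openin (semiregularization X) (topspace X)"
    using openin_semiregularization_interior_of_closure_of[of X "topspace X"] by simp
  then show "topspace X \<subseteq> topspace (semiregularization X)"
    by (rule openin_subset)
qed

lemma closedin_semiregularization_closure_of:
  assumes "openin X U"
  shows "closedin (semiregularization X) (X closure_of U)"
proof -
  have "X closure_of (X interior_of (X closure_of U)) = X closure_of U"
    by (rule subset_antisym)
      (simp_all add: closure_of_minimal interior_of_subset closure_of_mono
        openin_imp_subset_interior_of_closure_of assms)
  \<comment> \<open>Taking complements in \<open>cl (int (cl U)) = cl U\<close> shows that the
    complement of \<open>cl U\<close> is regular open.\<close>
  then have "topspace X - X closure_of U = X interior_of (X closure_of (topspace X - X closure_of U))"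
    by (simp add: interior_of_complement closure_of_complement)
  then have "openin (semiregularization X) (topspace X - X closure_of U)"
    using openin_semiregularization_interior_of_closure_of by metis
  then show ?thesis
    by (simp add: closedin_def closure_of_subset_topspace)
qed

lemma regular_space_semiregularization:
  assumes "\<And>U x. openin X U \<Longrightarrow> x \<in> U \<Longrightarrow>
    \<exists>W. openin X W \<and> x \<in> W \<and> X closure_of W \<subseteq> X interior_of (X closure_of U)"
  shows "regular_space (semiregularization X)"
  \<comment> \<open>Regularity becomes: every open set around a point contains a closed
    neighbourhood of it.\<close>
  unfolding neighbourhood_base_of_closedin[symmetric] neighbourhood_base_of
proof (intro allI impI, elim conjE)
  fix W x assume "openin (semiregularization X) W" "x \<in> W"
  then obtain U where U: "openin X U" "x \<in> U" "X interior_of (X closure_of U) \<subseteq> W"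
    unfolding openin_semiregularization by blast
  obtain V where V: "openin X V" "x \<in> V" "X closure_of V \<subseteq> X interior_of (X closure_of U)"
    using assms[OF U(1,2)] by blast
  show "\<exists>G F. openin (semiregularization X) G \<and> closedin (semiregularization X) F \<and>
      x \<in> G \<and> G \<subseteq> F \<and> F \<subseteq> W"
  proof (intro exI conjI)
    show "openin (semiregularization X) (X interior_of (X closure_of V))"
      by (rule openin_semiregularization_interior_of_closure_of)
    show "closedin (semiregularization X) (X closure_of V)"
      by (rule closedin_semiregularization_closure_of[OF V(1)])
    show "x \<in> X interior_of (X closure_of V)"
      using openin_imp_subset_interior_of_closure_of V(1,2) by blast
    show "X interior_of (X closure_of V) \<subseteq> X closure_of V"
      by (rule interior_of_subset)
    show "X closure_of V \<subseteq> W"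
      using V(3) U(3) by (rule subset_trans)
  qed
qed

section \<open>The effect of open shifts\<close>

lemma (in topological_monoid) closure_of_subset_interior_of_closure_of:
  assumes shifts: "open_shifts S T" and U: "openin T U" "x \<in> U"
  shows "\<exists>W. openin T W \<and> x \<in> W \<and> T closure_of W \<subseteq> T interior_of (T closure_of U)"
proof -
  let ?P = "{p \<in> topspace (prod_topology T T). (case p of (x, y) \<Rightarrow> x \<otimes> y) \<in> U}"
  have x: "x \<in> carrier S"
    using openin_subset[OF U(1)] U(2) topspace_eq by blast
  have "openin (prod_topology T T) ?P"
    by (rule openin_continuous_map_preimage[OF continuous_mult U(1)])
  \<comment> \<open>Continuity is used at \<open>(x, \<one>)\<close> because
    \<open>x \<otimes> \<one> = x\<close> lies in \<open>U\<close>.\<close>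
  moreover have "(x, \<one>) \<in> ?P"
    using x U(2) by (simp add: topspace_eq)
  ultimately obtain W V where W: "openin T W" "x \<in> W" and V: "openin T V" "\<one> \<in> V"
    and "W \<times> V \<subseteq> ?P"
    unfolding openin_prod_topology_alt by blast
  then have WV: "w \<otimes> v \<in> U" if "w \<in> W" "v \<in> V" for w v
    using that by auto
  have "T closure_of W \<subseteq> T interior_of (T closure_of U)"
  proof
    fix y assume y: "y \<in> T closure_of W"
    then have yc: "y \<in> carrier S"
      by (simp add: in_closure_of topspace_eq)
    \<comment> \<open>Right translation by \<open>v\<close> is continuous and maps \<open>W\<close>
      into \<open>U\<close>, hence \<open>cl W\<close> into \<open>cl U\<close>.\<close>
    have "y \<otimes> v \<in> T closure_of U" if v: "v \<in> V" for v
    proof -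
      have vc: "v \<in> topspace T"
        using v openin_subset[OF V(1)] by blast
      have "continuous_map T (prod_topology T T) (\<lambda>z. (z, v))"
        using vc by (simp add: continuous_map_pairwise o_def)
      from continuous_map_compose[OF this continuous_mult]
      have "continuous_map T T (\<lambda>z. z \<otimes> v)"
        by (simp add: o_def)
      then have "(\<lambda>z. z \<otimes> v) ` (T closure_of W) \<subseteq> T closure_of ((\<lambda>z. z \<otimes> v) ` W)"
        by (rule continuous_map_image_closure_subset)
      also have "\<dots> \<subseteq> T closure_of U"
        using WV v by (intro closure_of_mono) auto
      finally show ?thesis using y by blast
    qed
    then have "y <# V \<subseteq> T closure_of U"
      by (auto simp: l_coset_def)
    \<comment> \<open>Open shifts enter here: \<open>y <# V\<close> is an open neighbourhood of
      \<open>y\<close> inside \<open>cl U\<close>.\<close>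
    moreover have "openin T (y <# V)"
      using shifts yc V(1) unfolding open_shifts_def by blast
    moreover have "y \<in> y <# V"
      using V(2) yc by (force simp: l_coset_def)
    ultimately show "y \<in> T interior_of (T closure_of U)"
      unfolding interior_of_def by blast
  qed
  then show ?thesis using W by blast
qed

section \<open>Transfer to the reflections\<close>

text \<open>Regularity and T0 together give Hausdorff, hence all five axioms; so one target space
  serves every reflection.\<close>

lemma in_class_of_regular_t0:
  assumes "regular_space X" "t0_space X"
  shows "in_class c X"
  using regular_t0_imp_Hausdorff_space[OF assms] assms
  by (cases c) (auto simp: Hausdorff_imp_t1_space)

lemma countable_cellularity_of_reflection:
  assumes reg: "regular_space (semiregularization X)"
    and R: "reflection c X R \<phi>" and ccR: "countable_cellularity R"
  shows "countable_cellularity X"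
  unfolding countable_cellularity_iff
proof (intro allI impI)
  fix \<U> assume \<U>: "cellular_family X \<U>"
  define Z where "Z = semiregularization X"
  define q where "q = Kolmogorov_quotient Z"
  \<comment> \<open>\<open>q\<close> sends each point to a chosen topologically indistinguishable
    one, so \<open>Y\<close> realises the T0 quotient as a subspace of \<open>Z\<close>.\<close>
  define Y where "Y = subtopology Z (q ` topspace Z)"
  define A where "A U = X interior_of (X closure_of U)" for U
  have "in_class c Y"
    unfolding Y_def Z_def q_def
    by (intro in_class_of_regular_t0 regular_space_subtopology reg t0_space_Kolmogorov_quotient)
  moreover have "continuous_map Z Y q"
    unfolding Y_def q_def by (rule quotient_imp_continuous_map[OF quotient_map_Kolmogorov_quotient])
  then have "continuous_map X Y q"
    unfolding continuous_map
    by (auto simp: Z_def intro: openin_semiregularization_imp_openin)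
  ultimately obtain g where g: "continuous_map R Y g" "\<And>x. x \<in> topspace X \<Longrightarrow> q x = g (\<phi> x)"
    using ex1_implies_ex[OF reflection_universal[OF R]] by metis
  have img: "\<phi> ` topspace X = topspace R"
    using R by (simp add: reflection_def)
  have AZ: "openin Z (A U)" for U
    unfolding Z_def A_def by (rule openin_semiregularization_interior_of_closure_of)
  \<comment> \<open>\<open>q x\<close> and \<open>x\<close> lie in the same open sets of
    \<open>Z\<close>, so passing through \<open>R\<close> preserves membership in
    \<open>A U\<close>.\<close>
  have gA: "g (\<phi> x) \<in> A U \<longleftrightarrow> x \<in> A U" if "x \<in> topspace X" for x U
    using Kolmogorov_quotient_in_open[OF AZ] g(2)[OF that] unfolding q_def by metis
  have U: "openin X U" "U \<noteq> {}" if "U \<in> \<U>" for U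
    using \<U> that unfolding cellular_family_def by auto
  \<comment> \<open>\<open>U\<close> itself may fail to be open in \<open>Z\<close>, so
    \<open>g\<close> pulls back its regular open hull \<open>A U\<close> instead.\<close>
  let ?F = "\<lambda>U. {r \<in> topspace R. g r \<in> A U}"
  show "countable \<U>"
  proof (rule countable_cellularity_indexed[OF ccR])
    fix U assume "U \<in> \<U>"
    have "continuous_map R Z g"
      using g(1) unfolding Y_def continuous_map_in_subtopology by blast
    then show "openin R (?F U)"
      by (rule openin_continuous_map_preimage[OF _ AZ])
    obtain x where x: "x \<in> U" using U[OF \<open>U \<in> \<U>\<close>] by blast
    have "x \<in> topspace X" "x \<in> A U"
      using x openin_subset[OF U(1)] openin_imp_subset_interior_of_closure_of[OF U(1)] \<open>U \<in> \<U>\<close>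
      unfolding A_def by auto
    then have "\<phi> x \<in> ?F U"
      using gA by (simp flip: img)
    then show "?F U \<noteq> {}"
      by blast
  next
    fix U V assume UV: "U \<in> \<U>" "V \<in> \<U>" "U \<noteq> V"
    then have "disjnt U V"
      using \<U> unfolding cellular_family_def pairwise_def by blast
    then have "disjnt (A U) (A V)"
      unfolding A_def using UV U by (intro disjnt_interior_of_closure_of) auto
    then show "disjnt (?F U) (?F V)"
      by (auto simp: disjnt_iff)
  qed
qed

text \<open>Forward, \<open>\<phi>\<close> is a continuous surjection; backward, \<open>T\<close>
  has a regular semiregularization, through which cellular families pass to
  \<open>R\<close>.\<close>

lemma countable_cellularity_reflection_iff:
  assumes "topological_monoid S T" "open_shifts S T" "reflection c T R \<phi>"
  shows "countable_cellularity T \<longleftrightarrow> countable_cellularity R"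
proof
  assume "countable_cellularity T"
  then show "countable_cellularity R"
    by (rule countable_cellularity_continuous_image[of T R \<phi>])
      (use assms(3) in \<open>simp_all add: reflection_def\<close>)
next
  have "regular_space (semiregularization T)"
    by (intro regular_space_semiregularization
        topological_monoid.closure_of_subset_interior_of_closure_of[OF assms(1,2)])
  then show "countable_cellularity R \<Longrightarrow> countable_cellularity T"
    by (rule countable_cellularity_of_reflection[OF _ assms(3)])
qed

theorem theorem4p5:
  fixes S :: "('a, 'm) monoid_scheme" and T :: "'a topology"
    and R0 :: "'b0 topology" and R1 :: "'b1 topology" and R2 :: "'b2 topology"
    and R3 :: "'b3 topology" and Rr :: "'br topology"
  assumes "topological_monoid S T" and "open_shifts S T"
    and "reflection T0 T R0 \<phi>0"
    and "reflection T1 T R1 \<phi>1"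
    and "reflection T2 T R2 \<phi>2"
    and "reflection T3 T R3 \<phi>3"
    and "reflection Regular T Rr \<phi>r"
  shows "(countable_cellularity T \<longleftrightarrow> countable_cellularity R0) \<and>
         (countable_cellularity T \<longleftrightarrow> countable_cellularity R1) \<and>
         (countable_cellularity T \<longleftrightarrow> countable_cellularity R2) \<and>
         (countable_cellularity T \<longleftrightarrow> countable_cellularity R3) \<and>
         (countable_cellularity T \<longleftrightarrow> countable_cellularity Rr)"
  by (intro conjI assms(3-7)[THEN countable_cellularity_reflection_iff[OF assms(1,2)]])

end
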